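(* Let $q\in(0,1)$, let $f(z)=z+\sum_{n=2}^\infty A_{2n-1}z^{2n-1}$, and put $A_1=1$ and $B_n=\dfrac{A_n(1-q^n)}{1-q}$ for odd $n\ge 1$. Suppose that $$\sum_{n=1}^\infty|B_{2n-1}-B_{2n+1}|\le 1 .$$ Then $f\in\mathcal{K}_q$ with the function $g(z)=z/(1-z^2)$.
   Context: $\mathbb{D}=\{z\in\mathbb{C}:|z|<1\}$. $\mathcal{A}$ is the class of functions $f$ analytic in $\mathbb{D}$ with $f(0)=0=f'(0)-1$. $\mathcal{S}^*\subset\mathcal{A}$ is the class of univalent functions $g\in\mathcal{A}$ that are starlike with respect to the origin ($tw\in g(\mathbb{D})$ whenever $t\in[0,1]$, $w\in g(\mathbb{D})$). For $q\in(0,1)$ and $f\in\mathcal{A}$, the $q$-difference operator is $(D_qf)(z)=\dfrac{f(z)-f(qz)}{z(1-q)}$ for $z\in\mathbb{D}\setminus\{0\}$, and $(D_qf)(0)=f'(0)$. A function $f\in\mathcal{A}$ belongs to $\mathcal{K}_q$ ($q$-close-to-convex functions) if there exists $g\in\mathcal{S}^*$ such that $$\left|\frac{z}{g(z)}(D_qf)(z)-\frac{1}{1-q}\right|\le\frac{1}{1-q},\quad z\in\mathbb{D}$$ (where $z/g(z)$ is given its limit value $1$ at $z=0$); one then says that $f\in\mathcal{K}_q$ with the function $g$. The coefficients $A_n$ are complex numbers. *)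

theory Defs
  imports "HOL-Complex_Analysis.Complex_Analysis"
begin

abbreviation unit_disc :: "complex set" where
  "unit_disc \<equiv> ball 0 1"

definition class_A :: "(complex \<Rightarrow> complex) set" where
  "class_A = {f. f holomorphic_on unit_disc \<and> f 0 = 0 \<and> deriv f 0 = 1}"

text \<open>The library predicate \<open>starlike\<close> does not fix the centre, hence the explicit condition here.\<close>

definition starlike_class :: "(complex \<Rightarrow> complex) set" where
  "starlike_class = {g \<in> class_A. inj_on g unit_disc \<and>
     (\<forall>t\<in>{0..1::real}. \<forall>w\<in>g ` unit_disc. of_real t * w \<in> g ` unit_disc)}"

definition q_diff :: "real \<Rightarrow> (complex \<Rightarrow> complex) \<Rightarrow> complex \<Rightarrow> complex" where
  "q_diff q f z =
     (if z = 0 then deriv f 0 else (f z - f (of_real q * z)) / (z * (1 - of_real q)))"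

text \<open>The quotient \<open>z / g z\<close> is replaced by its limit \<open>1\<close> at the origin, where HOL would
  evaluate \<open>0 / 0\<close> to \<open>0\<close>. Elsewhere in the disc \<open>g z \<noteq> 0\<close>, by injectivity of \<open>g\<close>.\<close>

definition q_close_to_convex_with ::
  "real \<Rightarrow> (complex \<Rightarrow> complex) \<Rightarrow> (complex \<Rightarrow> complex) \<Rightarrow> bool" where
  "q_close_to_convex_with q f g \<longleftrightarrow> f \<in> class_A \<and> g \<in> starlike_class \<and>
     (\<forall>z\<in>unit_disc.
        cmod ((if z = 0 then 1 else z / g z) * q_diff q f z - 1 / (1 - of_real q)) \<le> 1 / (1 - q))"

definition q_close_to_convex :: "real \<Rightarrow> (complex \<Rightarrow> complex) set" where
  "q_close_to_convex q = {f. \<exists>g. q_close_to_convex_with q f g}"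

end

theory Submission
  imports Defs
begin

text \<open>
  Write \<open>b\<^sub>n = B\<^bsub>2n+1\<^esub>\<close> and \<open>d\<^sub>n = b\<^sub>n - b\<^bsub>n+1\<^esub>\<close>. The factors \<open>1 - q\<^sup>n\<close> in the definition
  of \<open>B\<close> are the ones that \<open>D\<^sub>q\<close> puts on \<open>z\<^sup>n\<close>, so \<open>(D\<^sub>q f)(z) = \<Sum> b\<^sub>n z\<^bsup>2n\<^esup>\<close>. For
  \<open>g(z) = z / (1 - z\<^sup>2)\<close> the quotient \<open>z / g(z)\<close> is \<open>1 - z\<^sup>2\<close>, and multiplication by it
  differences the coefficients:
  \<open>(1 - z\<^sup>2) (D\<^sub>q f)(z) = 1 - \<Sum> d\<^sub>n z\<^bsup>2n+2\<^esup>\<close> (\<open>summation_by_parts_power_series\<close>).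
  The last sum has modulus at most \<open>\<Sum> |d\<^sub>n| \<le> 1\<close>, so the distance of this expression to
  \<open>1 / (1 - q)\<close> is at most \<open>|1 - 1 / (1 - q)| + 1 = q / (1 - q) + 1 = 1 / (1 - q)\<close>.

  The same hypothesis gives convergence: bounded variation makes \<open>b\<^sub>n\<close> bounded
  (\<open>bounded_variation_imp_bounded\<close>), and \<open>|A\<^bsub>2n+1\<^esub>| \<le> |b\<^sub>n|\<close>, so the series of \<open>f\<close> converges in the whole disc.

  Finally \<open>g\<close> is starlike because it maps the disc onto the plane slit along the two rays
  \<open>{iy. |y| \<ge> 1/2}\<close>. The equation \<open>g(u) = c\<close> is a quadratic whose roots have product \<open>-1\<close>,
  so it is solvable in the disc unless both roots lie on the unit circle, and this happens
  exactly for \<open>c\<close> on the slits. A point that a factor \<open>t \<in> (0, 1]\<close> moves onto a slit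
  lies on it already (\<open>odd_koebe_preimage_in_closed_disc\<close>,
  \<open>odd_koebe_circle_value_not_in_disc\<close>).
\<close>

section \<open>Starlikeness of the odd Koebe function\<close>

lemma one_minus_square_nonzero:
  fixes z :: complex
  assumes "cmod z < 1"
  shows "1 - z ^ 2 \<noteq> 0"
proof
  assume "1 - z ^ 2 = 0"
  then have "cmod z ^ 2 = 1"
    by (metis eq_iff_diff_eq_0 norm_one norm_power)
  then show False
    using assms by (simp add: abs_square_eq_1)
qed

text \<open>
  With \<open>1 / g(z) = 1 / z - z\<close> the relation below is \<open>1 / g(z) = t / g(u)\<close>, stated without
  division. On the unit circle \<open>1 / u - u\<close> is \<open>- 2 i Im u\<close>, so the right side is an imaginary
  number of modulus at most \<open>2\<close>. In the punctured disc \<open>1 / z - z\<close> is imaginary only if \<open>z\<close> is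
  imaginary, and then its modulus is \<open>1 / |z| + |z| > 2\<close>.
\<close>

lemma odd_koebe_circle_value_not_in_disc:
  fixes u z :: complex and t :: real
  assumes u: "cmod u = 1" and z: "cmod z < 1" and t: "0 \<le> t" "t \<le> 1"
  shows "(1 - z ^ 2) * u \<noteq> of_real t * (1 - u ^ 2) * z"
proof
  assume eq: "(1 - z ^ 2) * u = of_real t * (1 - u ^ 2) * z"
  define s where "s = t * Im u"
  have u0: "u * cnj u = 1"
    using u by (simp add: complex_norm_square[symmetric])
  \<comment> \<open>On the circle, multiplying by \<open>cnj u\<close> is dividing by \<open>u\<close>.\<close>
  have "(1 - z ^ 2) * (u * cnj u) = of_real t * (cnj u - u * (u * cnj u)) * z"
    using arg_cong[OF eq, of "\<lambda>x. x * cnj u"] by (simp add: algebra_simps power2_eq_square)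
  then have "1 - z ^ 2 = of_real t * (cnj u - u) * z"
    by (simp add: u0)
  also have "of_real t * (cnj u - u) = - 2 * \<i> * of_real s"
    by (simp add: complex_eq_iff s_def)
  finally have q: "1 - z ^ 2 = - 2 * \<i> * of_real s * z" .
  have s1: "\<bar>s\<bar> \<le> 1"
    using t abs_Im_le_cmod[of u] u
    by (simp add: s_def abs_mult mult_le_one)
  define x y where "x = Re z" and "y = Im z"
  have re: "1 - x\<^sup>2 + y\<^sup>2 = 2 * s * y" and im: "- (x * y) = - (s * x)"
    using arg_cong[OF q, of Re] arg_cong[OF q, of Im]
    by (simp_all add: x_def y_def power2_eq_square)
  have lt: "x\<^sup>2 + y\<^sup>2 < 1"
    using z unfolding x_def y_def cmod_power2[symmetric]
    by (simp add: power_less_one_iff)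
  show False
  proof (cases "x = 0")
    case True
    then have "(y - s)\<^sup>2 = s\<^sup>2 - 1"
      using re by (simp add: power2_diff algebra_simps)
    moreover have "s\<^sup>2 \<le> 1"
      using s1 by (simp add: abs_square_le_1)
    ultimately have "y = s" "s\<^sup>2 = 1"
      using zero_le_power2[of "y - s"] by auto
    then show False
      using lt True by simp
  next
    case False
    then have "y = s"
      using im by simp
    then show False
      using re lt by (simp add: power2_eq_square)
  qed
qed

lemma odd_koebe_preimage_in_closed_disc:
  fixes c :: complex
  shows "\<exists>u. cmod u \<le> 1 \<and> u = c * (1 - u ^ 2)"
proof (cases "c = 0")
  case True
  then show ?thesis
    by (intro exI[of _ 0]) simp
next
  case False
  define s where "s = csqrt (1 + 4 * c ^ 2)"
  have s2: "s ^ 2 = 1 + 4 * c ^ 2"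
    by (simp add: s_def)
  define u v where "u = (- 1 + s) / (2 * c)" and "v = (- 1 - s) / (2 * c)"
  have root: "x = c * (1 - x ^ 2)" if "x = (- 1 + r) / (2 * c)" "r ^ 2 = 1 + 4 * c ^ 2" for x r
  proof -
    have "2 * c * x + 1 = r"
      using that(1) False by simp
    then have "(2 * c * x + 1) ^ 2 = 1 + 4 * c ^ 2"
      using that(2) by simp
    then have "4 * c * (x - c * (1 - x ^ 2)) = 0"
      by (simp add: power2_eq_square algebra_simps)
    then show ?thesis
      using False by simp
  qed
  have ru: "u = c * (1 - u ^ 2)"
    by (rule root[of u s]) (use s2 in \<open>simp_all add: u_def\<close>)
  have rv: "v = c * (1 - v ^ 2)"
    by (rule root[of v "- s"]) (use s2 in \<open>simp_all add: v_def\<close>)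
  have "u * v = (1 - s ^ 2) / (4 * c ^ 2)"
    by (simp add: u_def v_def power2_eq_square algebra_simps)
  also have "\<dots> = - 1"
    using False by (simp add: s2)
  finally have "cmod u * cmod v = 1"
    by (metis norm_minus_cancel norm_mult norm_one)
  then have "cmod u \<le> 1 \<or> cmod v \<le> 1"
    using less_1_mult[of "cmod u" "cmod v"] by linarith
  then show ?thesis
    using ru rv by blast
qed

lemma odd_koebe_starlike: "(\<lambda>z. z / (1 - z ^ 2)) \<in> starlike_class"
proof -
  let ?g = "\<lambda>z::complex. z / (1 - z ^ 2)"
  have nz: "1 - z ^ 2 \<noteq> 0" if "z \<in> unit_disc" for z :: complex
    using that one_minus_square_nonzero[of z] by simp
  have "?g holomorphic_on unit_disc"
    by (intro holomorphic_intros nz)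
  moreover have "(?g has_field_derivative 1) (at 0)"
    by (auto intro!: derivative_eq_intros)
  then have "deriv ?g 0 = 1"
    by (rule DERIV_imp_deriv)
  ultimately have "?g \<in> class_A"
    by (simp add: class_A_def)
  moreover have "inj_on ?g unit_disc"
  proof (rule inj_onI)
    fix z w :: complex
    assume z: "z \<in> unit_disc" and w: "w \<in> unit_disc" and eq: "?g z = ?g w"
    have "z * (1 - w ^ 2) = w * (1 - z ^ 2)"
      using eq nz[OF z] nz[OF w] by (simp add: frac_eq_eq)
    then have "(z - w) * (1 + z * w) = 0"
      by (simp add: power2_eq_square algebra_simps)
    moreover have "1 + z * w \<noteq> 0"
    proof
      assume "1 + z * w = 0"
      then have "z * w = - 1"
        by (simp add: add_eq_0_iff)
      then have "cmod z * cmod w = 1"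
        by (metis norm_minus_cancel norm_mult norm_one)
      moreover have "cmod z * cmod w < 1"
        using z w mult_strict_mono'[of "cmod z" 1 "cmod w" 1] by simp
      ultimately show False
        by simp
    qed
    ultimately show "z = w"
      by simp
  qed
  moreover have "of_real t * w \<in> ?g ` unit_disc"
    if t: "t \<in> {0..1}" and w: "w \<in> ?g ` unit_disc" for t :: real and w
  proof -
    obtain z where z: "z \<in> unit_disc" and wz: "w = ?g z"
      using w by blast
    obtain u where u1: "cmod u \<le> 1" and u: "u = of_real t * w * (1 - u ^ 2)"
      using odd_koebe_preimage_in_closed_disc[of "of_real t * w"] by blast
    have "u * (1 - z ^ 2) = of_real t * (w * (1 - z ^ 2)) * (1 - u ^ 2)"
      using arg_cong[OF u, of "\<lambda>x. x * (1 - z ^ 2)"] by (simp only: mult_ac)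
    then have "u * (1 - z ^ 2) = of_real t * z * (1 - u ^ 2)"
      using nz[OF z] by (simp add: wz)
    then have "(1 - z ^ 2) * u = of_real t * (1 - u ^ 2) * z"
      by (simp add: mult_ac)
    then have "cmod u \<noteq> 1"
      using odd_koebe_circle_value_not_in_disc[of u z t] z t by auto
    then have ud: "u \<in> unit_disc"
      using u1 by simp
    have "?g u = of_real t * w"
      unfolding nonzero_divide_eq_eq[OF nz[OF ud]] by (rule u)
    then show ?thesis
      by (rule rev_image_eqI[OF ud sym])
  qed
  ultimately show ?thesis
    unfolding starlike_class_def by blast
qed

section \<open>Power series with coefficients of bounded variation\<close>

lemma bounded_variation_imp_bounded:
  fixes b :: "nat \<Rightarrow> 'a::real_normed_vector"
  assumes "summable (\<lambda>n. norm (b n - b (Suc n)))"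
  shows "norm (b n) \<le> norm (b 0) + (\<Sum>n. norm (b n - b (Suc n)))"
proof -
  have "norm (b 0 - b n) = norm (\<Sum>k<n. b k - b (Suc k))"
    by (simp add: sum_lessThan_telescope')
  also have "\<dots> \<le> (\<Sum>k<n. norm (b k - b (Suc k)))"
    by (rule norm_sum)
  also have "\<dots> \<le> (\<Sum>n. norm (b n - b (Suc n)))"
    by (rule sum_le_suminf[OF assms]) auto
  finally show ?thesis
    using norm_triangle_ineq3[of "b 0" "b n"] by linarith
qed

lemma summable_power_series_bounded_coeffs:
  fixes a :: "nat \<Rightarrow> complex"
  assumes "\<And>n. cmod (a n) \<le> M" and "cmod w < 1"
  shows "summable (\<lambda>n. a n * w ^ n)"
proof (rule summable_comparison_test)
  show "\<exists>N. \<forall>n\<ge>N. norm (a n * w ^ n) \<le> M * cmod w ^ n"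
    using assms(1) by (simp add: norm_mult norm_power mult_right_mono)
  show "summable (\<lambda>n. M * cmod w ^ n)"
    using assms(2) by (intro summable_mult summable_geometric) simp
qed

text \<open>
  With \<open>w = z\<^sup>2\<close> the factor \<open>1 - w\<close> is \<open>z / g(z)\<close> for the odd Koebe function \<open>g\<close>; the right
  side isolates the coefficient differences whose sum is assumed small.
\<close>

lemma summation_by_parts_power_series:
  fixes b :: "nat \<Rightarrow> complex"
  assumes "summable (\<lambda>n. b n * w ^ n)"
  shows "(1 - w) * (\<Sum>n. b n * w ^ n) = b 0 - (\<Sum>n. (b n - b (Suc n)) * w ^ Suc n)"
proof -
  let ?P = "\<Sum>n. b n * w ^ n"
  have s0: "(\<lambda>n. b n * w ^ n) sums ?P"
    using assms by (rule summable_sums)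
  have "(\<lambda>n. b n * w ^ Suc n) sums (w * ?P)"
    using sums_mult[OF s0, of w] by (simp add: mult_ac)
  moreover have "(\<lambda>n. b (Suc n) * w ^ Suc n) sums (?P - b 0)"
    using s0 sums_Suc_iff[of "\<lambda>n. b n * w ^ n" "?P - b 0"] by simp
  ultimately have "(\<lambda>n. (b n - b (Suc n)) * w ^ Suc n) sums (w * ?P - (?P - b 0))"
    unfolding left_diff_distrib by (rule sums_diff)
  then show ?thesis
    by (simp add: sums_iff algebra_simps)
qed

lemma cmod_power_series_le_sum_coeffs:
  fixes d :: "nat \<Rightarrow> complex"
  assumes "summable (\<lambda>n. cmod (d n))" and "cmod w \<le> 1"
  shows "cmod (\<Sum>n. d n * w ^ Suc n) \<le> (\<Sum>n. cmod (d n))"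
proof -
  have le: "norm (d n * w ^ Suc n) \<le> cmod (d n)" for n
    using assms(2) power_le_one[of "cmod w" "Suc n"]
    by (simp add: norm_mult norm_power mult_left_le)
  have sm: "summable (\<lambda>n. norm (d n * w ^ Suc n))"
    by (rule summable_comparison_test[OF _ assms(1)]) (use le in auto)
  have "cmod (\<Sum>n. d n * w ^ Suc n) \<le> (\<Sum>n. norm (d n * w ^ Suc n))"
    by (rule summable_norm[OF sm])
  also have "\<dots> \<le> (\<Sum>n. cmod (d n))"
    by (rule suminf_le[OF le sm assms(1)])
  finally show ?thesis .
qed

text \<open>
  Pulling out one factor \<open>z\<close> leaves \<open>F(z\<^sup>2)\<close> for an ordinary power series \<open>F\<close>. So holomorphy
  follows by composition, and the product rule gives the derivative \<open>F(0) = a\<^sub>0\<close> at \<open>0\<close>.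
\<close>

lemma odd_power_series_in_class_A:
  fixes a :: "nat \<Rightarrow> complex"
  assumes bd: "\<And>n. cmod (a n) \<le> M" and a0: "a 0 = 1"
    and f: "\<And>z. z \<in> unit_disc \<Longrightarrow> f z = z * (\<Sum>n. a n * (z ^ 2) ^ n)"
  shows "f \<in> class_A"
proof -
  define F where "F w = (\<Sum>n. a n * w ^ n)" for w
  have "(\<lambda>n. a n * (w - 0) ^ n) sums F w" if "w \<in> unit_disc" for w
    using that summable_power_series_bounded_coeffs[OF bd, of w]
    by (simp add: F_def summable_sums)
  then have F: "F holomorphic_on unit_disc"
    by (rule power_series_holomorphic)
  have sq: "(\<lambda>z. z ^ 2) ` unit_disc \<subseteq> unit_disc"
    by (auto simp: norm_power power_less_one_iff)
  have F2: "(\<lambda>z. F (z ^ 2)) holomorphic_on unit_disc"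
    using holomorphic_on_compose_gen[OF _ F sq] by (simp add: o_def holomorphic_intros)
  then have "(\<lambda>z. z * F (z ^ 2)) holomorphic_on unit_disc"
    by (intro holomorphic_intros)
  then have "f holomorphic_on unit_disc"
    by (rule holomorphic_transform) (simp add: f F_def)
  moreover have "f 0 = 0"
    by (simp add: f)
  moreover have "deriv f 0 = 1"
  proof -
    obtain D where "((\<lambda>z. F (z ^ 2)) has_field_derivative D) (at 0)"
      using F2 by (metis centre_in_ball holomorphic_derivI open_ball zero_less_one)
    from DERIV_mult[OF DERIV_ident this]
    have "((\<lambda>z. z * F (z ^ 2)) has_field_derivative F 0) (at 0)"
      by simp
    moreover have "F 0 = 1"
      using powser_zero[of a] by (simp add: F_def a0)
    ultimately have "((\<lambda>z. z * F (z ^ 2)) has_field_derivative 1) (at 0)"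
      by simp
    then have "(f has_field_derivative 1) (at 0)"
      by (rule has_field_derivative_transform_within_open[where S = unit_disc])
        (simp_all add: f F_def)
    then show ?thesis
      by (rule DERIV_imp_deriv)
  qed
  ultimately show ?thesis
    by (simp add: class_A_def)
qed

section \<open>The criterion for q-close-to-convexity\<close>

text \<open>
  The operator is diagonal on monomials: it sends \<open>z\<^sup>m\<close> to \<open>(1 - q\<^sup>m) / (1 - q) z\<^bsup>m-1\<^esup>\<close>.
\<close>

lemma q_diff_odd_power_series:
  fixes a b :: "nat \<Rightarrow> complex"
  assumes q: "0 < q" "q < 1"
    and bd: "\<And>n. cmod (a n) \<le> M"
    and f: "\<And>z. z \<in> unit_disc \<Longrightarrow> f z = z * (\<Sum>n. a n * (z ^ 2) ^ n)"
    and b: "\<And>n. b n = a n * (1 - of_real q ^ (2 * n + 1)) / (1 - of_real q)"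
    and z: "z \<in> unit_disc" "z \<noteq> 0"
  shows "q_diff q f z = (\<Sum>n. b n * (z ^ 2) ^ n)"
proof -
  define p where "p = complex_of_real q"
  have p: "1 - p \<noteq> 0"
    using q by (simp add: p_def)
  have "cmod (p * z) \<le> 1 * cmod z"
    unfolding norm_mult using q by (intro mult_right_mono) (auto simp: p_def)
  then have pz: "p * z \<in> unit_disc"
    using z(1) by simp
  have sm: "(\<lambda>n. a n * (x ^ 2) ^ n) sums (\<Sum>n. a n * (x ^ 2) ^ n)" if "x \<in> unit_disc" for x
    using that summable_power_series_bounded_coeffs[OF bd, of "x ^ 2"]
    by (intro summable_sums) (simp add: norm_power power_less_one_iff)
  have fs: "(\<lambda>n. x * (a n * (x ^ 2) ^ n)) sums f x" if "x \<in> unit_disc" for x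
    using sums_mult[OF sm[OF that], of x] f[OF that] by simp
  have "(\<lambda>n. (z * (a n * (z ^ 2) ^ n) - (p * z) * (a n * ((p * z) ^ 2) ^ n)) / (z * (1 - p)))
      sums ((f z - f (p * z)) / (z * (1 - p)))"
    by (intro sums_divide sums_diff fs z pz)
  moreover have "(z * (a n * (z ^ 2) ^ n) - (p * z) * (a n * ((p * z) ^ 2) ^ n)) / (z * (1 - p))
      = b n * (z ^ 2) ^ n" for n
    using z(2) p
    by (simp add: b p_def[symmetric] power_mult_distrib power_mult[symmetric] field_simps)
  ultimately have "(\<lambda>n. b n * (z ^ 2) ^ n) sums q_diff q f z"
    using z(2) by (simp add: q_diff_def p_def)
  then show ?thesis
    by (simp add: sums_iff)
qed

theorem theorem2p5:
  fixes q :: real and f :: "complex \<Rightarrow> complex" and A B :: "nat \<Rightarrow> complex"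
  assumes "0 < q" and "q < 1"
    and "A 1 = 1"
    and "\<And>z. z \<in> unit_disc \<Longrightarrow>
           f z = z + (\<Sum>n. A (2 * (n + 2) - 1) * z ^ (2 * (n + 2) - 1))"
    and "\<And>n. odd n \<Longrightarrow> B n = A n * (1 - of_real q ^ n) / (1 - of_real q)"
    and "summable (\<lambda>n. cmod (B (2 * (n + 1) - 1) - B (2 * (n + 1) + 1)))"
    and "(\<Sum>n. cmod (B (2 * (n + 1) - 1) - B (2 * (n + 1) + 1))) \<le> 1"
  shows "f \<in> q_close_to_convex q \<and> q_close_to_convex_with q f (\<lambda>z. z / (1 - z ^ 2))"
proof -
  let ?g = "\<lambda>z::complex. z / (1 - z ^ 2)"
  define a b where "a n = A (2 * n + 1)" and "b n = B (2 * n + 1)" for n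
  have ba: "b n = a n * (1 - of_real q ^ (2 * n + 1)) / (1 - of_real q)" for n
    using assms(5)[of "2 * n + 1"] by (simp add: a_def b_def)
  have a0: "a 0 = 1"
    using assms(3) by (simp add: a_def)
  have b0: "b 0 = 1"
    using ba[of 0] a0 assms(2) by simp
  have sd: "summable (\<lambda>n. cmod (b n - b (Suc n)))"
    and d1: "(\<Sum>n. cmod (b n - b (Suc n))) \<le> 1"
    using assms(6,7) by (simp_all add: b_def)
  have bb: "cmod (b n) \<le> 2" for n
    using bounded_variation_imp_bounded[OF sd, of n] d1 b0 by simp
  have ab: "cmod (a n) \<le> 2" for n
  proof -
    have qn: "q ^ (2 * n + 1) \<le> q"
      using power_decreasing[of 1 "2 * n + 1" q] assms(1,2) by simp
    then have qn1: "q ^ (2 * n + 1) < 1"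
      using assms(2) by linarith
    have "(1 - complex_of_real q ^ (2 * n + 1)) / (1 - of_real q)
        = of_real ((1 - q ^ (2 * n + 1)) / (1 - q))"
      by simp
    then have "cmod (b n) = cmod (a n) * ((1 - q ^ (2 * n + 1)) / (1 - q))"
      unfolding ba times_divide_eq_right[symmetric] norm_mult
      using qn1 assms(2) by (simp only: norm_of_real) simp
    moreover have "1 \<le> (1 - q ^ (2 * n + 1)) / (1 - q)"
      using qn assms(2) by (simp add: le_divide_eq)
    ultimately have "cmod (a n) \<le> cmod (b n)"
      by (metis mult.right_neutral mult_left_mono norm_ge_zero)
    then show ?thesis
      using bb[of n] by linarith
  qed
  have f: "f z = z * (\<Sum>n. a n * (z ^ 2) ^ n)" if z: "z \<in> unit_disc" for z
  proof -
    have "summable (\<lambda>n. a n * (z ^ 2) ^ n)"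
      using z by (intro summable_power_series_bounded_coeffs[OF ab])
        (simp add: norm_power power_less_one_iff)
    then have "(\<lambda>n. z * (a n * (z ^ 2) ^ n)) sums (z * (\<Sum>n. a n * (z ^ 2) ^ n))"
      by (intro sums_mult summable_sums)
    then have "(\<lambda>n. z * (a (Suc n) * (z ^ 2) ^ Suc n)) sums
        (z * (\<Sum>n. a n * (z ^ 2) ^ n) - z)"
      by (subst sums_Suc_iff) (simp add: a0)
    moreover have "z * (a (Suc n) * (z ^ 2) ^ Suc n)
        = A (2 * (n + 2) - 1) * z ^ (2 * (n + 2) - 1)" for n
    proof -
      have "2 * (n + 2) - 1 = 2 * Suc n + 1"
        by simp
      then show ?thesis
        by (simp only: a_def power_mult[symmetric] power_add power_one_right mult_ac)
    qed
    ultimately have "(\<lambda>n. A (2 * (n + 2) - 1) * z ^ (2 * (n + 2) - 1)) sums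
        (z * (\<Sum>n. a n * (z ^ 2) ^ n) - z)"
      by (simp only:)
    then show ?thesis
      using assms(4)[OF z] by (simp only: sums_iff) simp
  qed
  have fA: "f \<in> class_A"
    using ab a0 f by (rule odd_power_series_in_class_A)
  have centre: "cmod (1 - 1 / (1 - of_real q)) + 1 = 1 / (1 - q)"
  proof -
    have "1 - 1 / (1 - complex_of_real q) = of_real (1 - 1 / (1 - q))"
      by simp
    then have "cmod (1 - 1 / (1 - of_real q)) = \<bar>1 - 1 / (1 - q)\<bar>"
      by (simp only: norm_of_real)
    also have "\<dots> = 1 / (1 - q) - 1"
      using assms(1,2) by (simp add: abs_of_nonpos le_divide_eq)
    finally show ?thesis
      by simp
  qed
  have "cmod ((if z = 0 then 1 else z / ?g z) * q_diff q f z - 1 / (1 - of_real q)) \<le> 1 / (1 - q)"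
    if z: "z \<in> unit_disc" for z
  proof (cases "z = 0")
    case True
    then show ?thesis
      using fA centre by (simp add: q_diff_def class_A_def)
  next
    case False
    define S where "S = (\<Sum>n. (b n - b (Suc n)) * (z ^ 2) ^ Suc n)"
    have z2: "cmod (z ^ 2) < 1"
      using z by (simp add: norm_power power_less_one_iff)
    have "(if z = 0 then 1 else z / ?g z) = 1 - z ^ 2"
      using False by simp
    moreover have "q_diff q f z = (\<Sum>n. b n * (z ^ 2) ^ n)"
      using q_diff_odd_power_series[OF assms(1,2) ab f ba z False] .
    moreover have "(1 - z ^ 2) * (\<Sum>n. b n * (z ^ 2) ^ n) = 1 - S"
      using summation_by_parts_power_series[OF summable_power_series_bounded_coeffs[of b, OF bb z2]]
      unfolding S_def b0 .
    ultimately have "(if z = 0 then 1 else z / ?g z) * q_diff q f z - 1 / (1 - of_real q)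
        = (1 - 1 / (1 - of_real q)) - S"
      by (simp only:) (simp add: algebra_simps)
    moreover have "cmod S \<le> 1"
      using cmod_power_series_le_sum_coeffs[OF sd, of "z ^ 2"] z2 d1 by (simp add: S_def)
    ultimately show ?thesis
      using norm_triangle_ineq4[of "1 - 1 / (1 - complex_of_real q)" S] centre by (simp only:)
  qed
  then have "q_close_to_convex_with q f ?g"
    using fA odd_koebe_starlike by (simp add: q_close_to_convex_with_def)
  then show ?thesis
    unfolding q_close_to_convex_def by blast
qed

end
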